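(* Let $T$ be a first-order theory in a countable language $L$, let $\mathcal{U}$ be a monster model of $T$, and let $\varphi(x;y)$ be an NIP partitioned $L$-formula (without parameters). Define $f:\mathcal{U}^x\times\mathcal{U}^y\to\{0,1\}$ by $f(a,b)=1$ if $\mathcal{U}\models\varphi(a,b)$ and $f(a,b)=0$ otherwise. Then the map $\Psi_f:\operatorname{conv}(\mathcal{U}^x)\times\operatorname{conv}(\mathcal{U}^y)\to[0,1]$ is dependent.
   Context: A formula $\varphi(x;y)$ is IP if for every $n\in\mathbb{N}$ there is $A\subseteq\mathcal{U}^{x}$ with $|A|\ge n$ such that for every $K\subseteq A$ there is $b_K\in\mathcal{U}^y$ with $\{c\in A:\mathcal{U}\models\varphi(c,b_K)\}=K$; otherwise it is NIP. For a set $X$, $\operatorname{conv}(X)$ denotes the set of finitely supported probability measures $\sum_{i=1}^n r_i\delta_{x_i}$ on $\mathcal{P}(X)$ ($n\in\mathbb{N}$, $x_i\in X$, $r_i>0$, $\sum r_i=1$, $\delta_{x_i}$ the Dirac measure). For $f:X\times Y\to\{0,1\}$, $\Psi_f(\mu,\nu)=\sum_{i=1}^n\sum_{j=1}^m r_is_jf(a_i,b_j)$ where $\mu=\sum_i r_i\delta_{a_i}$, $\nu=\sum_j s_j\delta_{b_j}$. For sets $X,Y$, a map $g:X\times Y\to[0,1]$, $r\in(0,1)$, $\epsilon>0$ and $A\subseteq X$: $g$ $(r,\epsilon)$-shatters $A$ if for every $K\subseteq A$ there is $b_K\in Y$ with $\{a\in A: g(a,b_K)\le r\}=K$ and $\{a\in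 A: g(a,b_K)\ge r+\epsilon\}=A\setminus K$. $g$ is $(r,\epsilon)$-independent if for every $n\in\mathbb{N}$ there is $A\subseteq X$ with $|A|>n$ which $g$ $(r,\epsilon)$-shatters; $g$ is independent if it is $(r,\epsilon)$-independent for some $r\in(0,1)$, $\epsilon>0$; and $g$ is dependent if it is not independent. *)

theory Defs
  imports "HOL-Probability.Probability_Mass_Function"
begin

unbundle cardinal_syntax

record ('f, 'r) lang =
  fun_syms :: "'f set"
  fun_ar :: "'f \<Rightarrow> nat"
  rel_syms :: "'r set"
  rel_ar :: "'r \<Rightarrow> nat"

definition countable_lang :: "('f, 'r) lang \<Rightarrow> bool" where
  "countable_lang L \<longleftrightarrow> countable (fun_syms L) \<and> countable (rel_syms L)"

datatype 'f tm = Var nat | App 'f "'f tm list"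

datatype ('f, 'r) fm =
    Bot
  | Eq "'f tm" "'f tm"
  | Rel 'r "'f tm list"
  | Imp "('f, 'r) fm" "('f, 'r) fm"
  | All nat "('f, 'r) fm"

primrec wf_tm :: "('f, 'r) lang \<Rightarrow> 'f tm \<Rightarrow> bool" where
  "wf_tm L (Var v) \<longleftrightarrow> True"
| "wf_tm L (App f ts) \<longleftrightarrow> f \<in> fun_syms L \<and> length ts = fun_ar L f \<and> list_all (wf_tm L) ts"

primrec wf_fm :: "('f, 'r) lang \<Rightarrow> ('f, 'r) fm \<Rightarrow> bool" where
  "wf_fm L Bot \<longleftrightarrow> True"
| "wf_fm L (Eq s t) \<longleftrightarrow> wf_tm L s \<and> wf_tm L t"
| "wf_fm L (Rel R ts) \<longleftrightarrow> R \<in> rel_syms L \<and> length ts = rel_ar L R \<and> list_all (wf_tm L) ts"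
| "wf_fm L (Imp \<phi> \<psi>) \<longleftrightarrow> wf_fm L \<phi> \<and> wf_fm L \<psi>"
| "wf_fm L (All v \<phi>) \<longleftrightarrow> wf_fm L \<phi>"

primrec vars_tm :: "'f tm \<Rightarrow> nat set" where
  "vars_tm (Var v) = {v}"
| "vars_tm (App f ts) = \<Union> (set (map vars_tm ts))"

primrec fv :: "('f, 'r) fm \<Rightarrow> nat set" where
  "fv Bot = {}"
| "fv (Eq s t) = vars_tm s \<union> vars_tm t"
| "fv (Rel R ts) = \<Union> (set (map vars_tm ts))"
| "fv (Imp \<phi> \<psi>) = fv \<phi> \<union> fv \<psi>"
| "fv (All v \<phi>) = fv \<phi> - {v}"

record ('a, 'f, 'r) struct =
  univ :: "'a set"
  fun_int :: "'f \<Rightarrow> 'a list \<Rightarrow> 'a"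
  rel_int :: "'r \<Rightarrow> 'a list \<Rightarrow> bool"

definition is_struct :: "('f, 'r) lang \<Rightarrow> ('a, 'f, 'r) struct \<Rightarrow> bool" where
  "is_struct L M \<longleftrightarrow> univ M \<noteq> {} \<and>
     (\<forall>f\<in>fun_syms L. \<forall>as. length as = fun_ar L f \<and> set as \<subseteq> univ M \<longrightarrow> fun_int M f as \<in> univ M)"

primrec eval_tm :: "('a, 'f, 'r) struct \<Rightarrow> (nat \<Rightarrow> 'a) \<Rightarrow> 'f tm \<Rightarrow> 'a" where
  "eval_tm M e (Var v) = e v"
| "eval_tm M e (App f ts) = fun_int M f (map (eval_tm M e) ts)"

primrec sat :: "('a, 'f, 'r) struct \<Rightarrow> (nat \<Rightarrow> 'a) \<Rightarrow> ('f, 'r) fm \<Rightarrow> bool" where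
  "sat M e Bot \<longleftrightarrow> False"
| "sat M e (Eq s t) \<longleftrightarrow> eval_tm M e s = eval_tm M e t"
| "sat M e (Rel R ts) \<longleftrightarrow> rel_int M R (map (eval_tm M e) ts)"
| "sat M e (Imp \<phi> \<psi>) \<longleftrightarrow> (sat M e \<phi> \<longrightarrow> sat M e \<psi>)"
| "sat M e (All v \<phi>) \<longleftrightarrow> (\<forall>a\<in>univ M. sat M (e(v := a)) \<phi>)"

definition is_theory :: "('f, 'r) lang \<Rightarrow> ('f, 'r) fm set \<Rightarrow> bool" where
  "is_theory L T \<longleftrightarrow> (\<forall>\<sigma>\<in>T. wf_fm L \<sigma> \<and> fv \<sigma> = {})"

definition is_model :: "('f, 'r) lang \<Rightarrow> ('f, 'r) fm set \<Rightarrow> ('a, 'f, 'r) struct \<Rightarrow> bool" where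
  "is_model L T M \<longleftrightarrow> is_struct L M \<and> (\<forall>\<sigma>\<in>T. \<forall>e. range e \<subseteq> univ M \<longrightarrow> sat M e \<sigma>)"

text \<open>
  A formula in the single variable 0 with parameters from A is represented by a pair of a formula
  and an assignment that sends all its other free variables into A.
\<close>

definition param_formulas ::
  "('f, 'r) lang \<Rightarrow> 'a set \<Rightarrow> (('f, 'r) fm \<times> (nat \<Rightarrow> 'a)) set" where
  "param_formulas L A = {(\<phi>, e). wf_fm L \<phi> \<and> e ` (fv \<phi> - {0}) \<subseteq> A}"

definition realizes ::
  "('a, 'f, 'r) struct \<Rightarrow> 'a \<Rightarrow> (('f, 'r) fm \<times> (nat \<Rightarrow> 'a)) set \<Rightarrow> bool" where
  "realizes M a p \<longleftrightarrow> (\<forall>(\<phi>, e)\<in>p. sat M (e(0 := a)) \<phi>)"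

definition saturated :: "'k rel \<Rightarrow> ('f, 'r) lang \<Rightarrow> ('a, 'f, 'r) struct \<Rightarrow> bool" where
  "saturated \<kappa> L M \<longleftrightarrow>
     (\<forall>A p. A \<subseteq> univ M \<and> |A| <o \<kappa> \<and> p \<subseteq> param_formulas L A \<and>
        (\<forall>q\<subseteq>p. finite q \<longrightarrow> (\<exists>a\<in>univ M. realizes M a q)) \<longrightarrow>
        (\<exists>a\<in>univ M. realizes M a p))"

definition partial_elementary ::
  "('f, 'r) lang \<Rightarrow> ('a, 'f, 'r) struct \<Rightarrow> 'a set \<Rightarrow> ('a \<Rightarrow> 'a) \<Rightarrow> bool" where
  "partial_elementary L M A h \<longleftrightarrow> A \<subseteq> univ M \<and> h ` A \<subseteq> univ M \<and>
     (\<forall>\<phi> e. wf_fm L \<phi> \<and> e ` fv \<phi> \<subseteq> A \<longrightarrow> (sat M e \<phi> \<longleftrightarrow> sat M (h \<circ> e) \<phi>))"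

definition automorphism ::
  "('f, 'r) lang \<Rightarrow> ('a, 'f, 'r) struct \<Rightarrow> ('a \<Rightarrow> 'a) \<Rightarrow> bool" where
  "automorphism L M \<sigma> \<longleftrightarrow> bij_betw \<sigma> (univ M) (univ M) \<and>
     (\<forall>f\<in>fun_syms L. \<forall>as. length as = fun_ar L f \<and> set as \<subseteq> univ M \<longrightarrow>
        \<sigma> (fun_int M f as) = fun_int M f (map \<sigma> as)) \<and>
     (\<forall>R\<in>rel_syms L. \<forall>as. length as = rel_ar L R \<and> set as \<subseteq> univ M \<longrightarrow>
        (rel_int M R as \<longleftrightarrow> rel_int M R (map \<sigma> as)))"

definition strongly_homogeneous ::
  "'k rel \<Rightarrow> ('f, 'r) lang \<Rightarrow> ('a, 'f, 'r) struct \<Rightarrow> bool" where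
  "strongly_homogeneous \<kappa> L M \<longleftrightarrow>
     (\<forall>A h. |A| <o \<kappa> \<and> partial_elementary L M A h \<longrightarrow>
        (\<exists>\<sigma>. automorphism L M \<sigma> \<and> (\<forall>a\<in>A. \<sigma> a = h a)))"

text \<open>
  The cardinal \<open>\<kappa>\<close> lives on a type of its own, so that it is not bounded by the
  size of the structure (which may be finite). There are always infinitely many formulas, so
  \<open>\<kappa>\<close> is uncountable.
\<close>

definition monster_model ::
  "'k rel \<Rightarrow> ('f, 'r) lang \<Rightarrow> ('f, 'r) fm set \<Rightarrow> ('a, 'f, 'r) struct \<Rightarrow> bool" where
  "monster_model \<kappa> L T U \<longleftrightarrow>
     Card_order \<kappa> \<and> |{\<phi>. wf_fm L \<phi>}| <o \<kappa> \<and>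
     is_model L T U \<and> saturated \<kappa> L U \<and> strongly_homogeneous \<kappa> L U"

definition partitioned_formula ::
  "('f, 'r) lang \<Rightarrow> nat set \<Rightarrow> nat set \<Rightarrow> ('f, 'r) fm \<Rightarrow> bool" where
  "partitioned_formula L x y \<phi> \<longleftrightarrow>
     wf_fm L \<phi> \<and> finite x \<and> finite y \<and> x \<inter> y = {} \<and> fv \<phi> \<subseteq> x \<union> y"

definition tuples :: "('a, 'f, 'r) struct \<Rightarrow> nat set \<Rightarrow> (nat \<Rightarrow> 'a) set" where
  "tuples U x = x \<rightarrow>\<^sub>E univ U"

definition holds ::
  "('a, 'f, 'r) struct \<Rightarrow> nat set \<Rightarrow> ('f, 'r) fm \<Rightarrow> (nat \<Rightarrow> 'a) \<Rightarrow> (nat \<Rightarrow> 'a) \<Rightarrow> bool" where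
  "holds U x \<phi> a b \<longleftrightarrow> sat U (\<lambda>v. if v \<in> x then a v else b v) \<phi>"

text \<open>Cardinality bounds are guarded by finiteness because \<open>card\<close> is 0 on infinite sets.\<close>

definition IP :: "('a, 'f, 'r) struct \<Rightarrow> nat set \<Rightarrow> nat set \<Rightarrow> ('f, 'r) fm \<Rightarrow> bool" where
  "IP U x y \<phi> \<longleftrightarrow>
     (\<forall>n::nat. \<exists>A\<subseteq>tuples U x. (finite A \<longrightarrow> n \<le> card A) \<and>
        (\<forall>K\<subseteq>A. \<exists>b\<in>tuples U y. {c \<in> A. holds U x \<phi> c b} = K))"

definition NIP :: "('a, 'f, 'r) struct \<Rightarrow> nat set \<Rightarrow> nat set \<Rightarrow> ('f, 'r) fm \<Rightarrow> bool" where
  "NIP U x y \<phi> \<longleftrightarrow> \<not> IP U x y \<phi>"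

definition formula_fun ::
  "('a, 'f, 'r) struct \<Rightarrow> nat set \<Rightarrow> ('f, 'r) fm \<Rightarrow> (nat \<Rightarrow> 'a) \<Rightarrow> (nat \<Rightarrow> 'a) \<Rightarrow> real" where
  "formula_fun U x \<phi> a b = (if holds U x \<phi> a b then 1 else 0)"

definition conv_measures :: "'a set \<Rightarrow> 'a pmf set" where
  "conv_measures X = {\<mu>. finite (set_pmf \<mu>) \<and> set_pmf \<mu> \<subseteq> X}"

definition Psi :: "('a \<Rightarrow> 'b \<Rightarrow> real) \<Rightarrow> 'a pmf \<Rightarrow> 'b pmf \<Rightarrow> real" where
  "Psi f \<mu> \<nu> = (\<Sum>a\<in>set_pmf \<mu>. \<Sum>b\<in>set_pmf \<nu>. pmf \<mu> a * pmf \<nu> b * f a b)"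

text \<open>
  The next facts confirm that these are the convex combinations of Dirac measures at points of X,
  and that Psi may be computed from any such representation (with possibly repeated points).
\<close>

definition dirac_rep :: "'a set \<Rightarrow> 'a pmf \<Rightarrow> nat \<Rightarrow> (nat \<Rightarrow> real) \<Rightarrow> (nat \<Rightarrow> 'a) \<Rightarrow> bool" where
  "dirac_rep X \<mu> n r x \<longleftrightarrow> (\<forall>i<n. x i \<in> X \<and> r i > 0) \<and> (\<Sum>i<n. r i) = 1 \<and>
     (\<forall>S. measure \<mu> S = (\<Sum>i<n. r i * indicator S (x i)))"

lemma dirac_rep_pmf:
  assumes "dirac_rep X \<mu> n r x"
  shows "pmf \<mu> a = (\<Sum>i | i < n \<and> x i = a. r i)" "set_pmf \<mu> = x ` {..<n}"
proof -
  have *: "pmf \<mu> a = (\<Sum>i | i < n \<and> x i = a. r i)" for a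
  proof -
    have "pmf \<mu> a = (\<Sum>i<n. r i * indicator {a} (x i))"
      using assms unfolding dirac_rep_def by (simp flip: measure_pmf_single)
    also have "\<dots> = (\<Sum>i<n. if x i = a then r i else 0)"
      by (intro sum.cong) (auto simp: indicator_def)
    also have "\<dots> = (\<Sum>i | i < n \<and> x i = a. r i)"
      by (simp add: sum.inter_filter [symmetric])
    finally show ?thesis .
  qed
  then show "pmf \<mu> a = (\<Sum>i | i < n \<and> x i = a. r i)" .
  have pos: "r i > 0" if "i < n" for i
    using assms that by (simp add: dirac_rep_def)
  have "a \<in> set_pmf \<mu> \<longleftrightarrow> a \<in> x ` {..<n}" for a
  proof -
    have "(\<Sum>i | i < n \<and> x i = a. r i) = 0 \<longleftrightarrow> (\<forall>i\<in>{i. i < n \<and> x i = a}. r i = 0)"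
      by (rule sum_nonneg_eq_0_iff) (auto intro: less_imp_le pos)
    then show ?thesis
      using pos by (fastforce simp: set_pmf_iff *)
  qed
  then show "set_pmf \<mu> = x ` {..<n}" by blast
qed

lemma conv_measures_iff: "\<mu> \<in> conv_measures X \<longleftrightarrow> (\<exists>n r x. dirac_rep X \<mu> n r x)"
proof
  assume "\<mu> \<in> conv_measures X"
  then have fin: "finite (set_pmf \<mu>)" and sub: "set_pmf \<mu> \<subseteq> X"
    by (auto simp: conv_measures_def)
  obtain x where x: "bij_betw x {..<card (set_pmf \<mu>)} (set_pmf \<mu>)"
    using ex_bij_betw_nat_finite [OF fin] by (auto simp: atLeast0LessThan)
  have "measure \<mu> S = (\<Sum>i<card (set_pmf \<mu>). pmf \<mu> (x i) * indicator S (x i))" for S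
  proof -
    have "measure \<mu> S = measure \<mu> (S \<inter> set_pmf \<mu>)"
      by (simp add: measure_Int_set_pmf)
    also have "\<dots> = (\<Sum>a\<in>S \<inter> set_pmf \<mu>. pmf \<mu> a)"
      using fin by (simp add: measure_measure_pmf_finite)
    also have "\<dots> = (\<Sum>a\<in>set_pmf \<mu>. pmf \<mu> a * indicator S a)"
      using fin by (intro sum.mono_neutral_cong_left) (auto simp: indicator_def)
    also have "\<dots> = (\<Sum>i<card (set_pmf \<mu>). pmf \<mu> (x i) * indicator S (x i))"
      using sum.reindex_bij_betw [OF x, of "\<lambda>a. pmf \<mu> a * indicator S a"] by simp
    finally show ?thesis .
  qed
  moreover have "(\<Sum>i<card (set_pmf \<mu>). pmf \<mu> (x i)) = 1"
    using sum.reindex_bij_betw [OF x, of "pmf \<mu>"] sum_pmf_eq_1 [OF fin order_refl] by simp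
  moreover have "x i \<in> X \<and> pmf \<mu> (x i) > 0" if "i < card (set_pmf \<mu>)" for i
    using bij_betwE [OF x] sub that by (auto simp: pmf_positive)
  ultimately have "dirac_rep X \<mu> (card (set_pmf \<mu>)) (\<lambda>i. pmf \<mu> (x i)) x"
    by (auto simp: dirac_rep_def)
  then show "\<exists>n r x. dirac_rep X \<mu> n r x" by blast
next
  assume "\<exists>n r x. dirac_rep X \<mu> n r x"
  then obtain n r x where d: "dirac_rep X \<mu> n r x" by blast
  from dirac_rep_pmf(2) [OF d] d show "\<mu> \<in> conv_measures X"
    by (auto simp: conv_measures_def dirac_rep_def)
qed

lemma dirac_rep_sum:
  assumes "dirac_rep X \<mu> n r x"
  shows "(\<Sum>a\<in>set_pmf \<mu>. pmf \<mu> a * h a) = (\<Sum>i<n. r i * h (x i))"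
proof -
  have "(\<Sum>a\<in>x ` {..<n}. pmf \<mu> a * h a) =
        (\<Sum>a\<in>x ` {..<n}. \<Sum>i\<in>{i \<in> {..<n}. x i = a}. r i * h (x i))"
    by (intro sum.cong) (auto simp: dirac_rep_pmf(1) [OF assms] sum_distrib_right)
  also have "\<dots> = (\<Sum>i<n. r i * h (x i))"
    by (rule sum.group) auto
  finally show ?thesis by (simp add: dirac_rep_pmf(2) [OF assms])
qed

lemma Psi_dirac_rep:
  assumes "dirac_rep X \<mu> n r a" "dirac_rep Y \<nu> m s b"
  shows "Psi f \<mu> \<nu> = (\<Sum>i<n. \<Sum>j<m. r i * s j * f (a i) (b j))"
proof -
  have "Psi f \<mu> \<nu> = (\<Sum>c\<in>set_pmf \<mu>. pmf \<mu> c * (\<Sum>d\<in>set_pmf \<nu>. pmf \<nu> d * f c d))"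
    by (simp add: Psi_def sum_distrib_left mult.assoc)
  also have "\<dots> = (\<Sum>i<n. r i * (\<Sum>j<m. s j * f (a i) (b j)))"
    by (simp add: dirac_rep_sum [OF assms(1)] dirac_rep_sum [OF assms(2)])
  finally show ?thesis by (simp add: sum_distrib_left mult.assoc)
qed

lemma Psi_range:
  assumes "\<mu> \<in> conv_measures X" "\<nu> \<in> conv_measures Y"
    and "\<And>a b. a \<in> X \<Longrightarrow> b \<in> Y \<Longrightarrow> f a b \<in> {0, 1}"
  shows "Psi f \<mu> \<nu> \<in> {0..1}"
proof -
  have fin: "finite (set_pmf \<mu>)" "finite (set_pmf \<nu>)"
    and sub: "set_pmf \<mu> \<subseteq> X" "set_pmf \<nu> \<subseteq> Y"
    using assms by (auto simp: conv_measures_def)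
  have f: "0 \<le> f a b" "f a b \<le> 1" if "a \<in> set_pmf \<mu>" "b \<in> set_pmf \<nu>" for a b
  proof -
    have "a \<in> X" "b \<in> Y" using that sub by auto
    from assms(3) [OF this] show "0 \<le> f a b" "f a b \<le> 1" by auto
  qed
  have "0 \<le> Psi f \<mu> \<nu>"
    unfolding Psi_def by (intro sum_nonneg mult_nonneg_nonneg f) auto
  moreover have "Psi f \<mu> \<nu> \<le> (\<Sum>a\<in>set_pmf \<mu>. \<Sum>b\<in>set_pmf \<nu>. pmf \<mu> a * pmf \<nu> b)"
    unfolding Psi_def by (intro sum_mono mult_left_le f) auto
  moreover have "\<dots> = 1"
    using sum_pmf_eq_1 [OF fin(1) order_refl] sum_pmf_eq_1 [OF fin(2) order_refl]
    by (simp flip: sum_distrib_left)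
  ultimately show ?thesis by simp
qed

definition shatters ::
  "'b set \<Rightarrow> ('a \<Rightarrow> 'b \<Rightarrow> real) \<Rightarrow> real \<Rightarrow> real \<Rightarrow> 'a set \<Rightarrow> bool" where
  "shatters Y g r \<epsilon> A \<longleftrightarrow>
     (\<forall>K\<subseteq>A. \<exists>b\<in>Y. {a \<in> A. g a b \<le> r} = K \<and> {a \<in> A. g a b \<ge> r + \<epsilon>} = A - K)"

definition independent_at ::
  "'a set \<Rightarrow> 'b set \<Rightarrow> ('a \<Rightarrow> 'b \<Rightarrow> real) \<Rightarrow> real \<Rightarrow> real \<Rightarrow> bool" where
  "independent_at X Y g r \<epsilon> \<longleftrightarrow>
     (\<forall>n::nat. \<exists>A\<subseteq>X. (finite A \<longrightarrow> n < card A) \<and> shatters Y g r \<epsilon> A)"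

definition independent_map :: "'a set \<Rightarrow> 'b set \<Rightarrow> ('a \<Rightarrow> 'b \<Rightarrow> real) \<Rightarrow> bool" where
  "independent_map X Y g \<longleftrightarrow> (\<exists>r \<epsilon>. 0 < r \<and> r < 1 \<and> 0 < \<epsilon> \<and> independent_at X Y g r \<epsilon>)"

definition dependent_map :: "'a set \<Rightarrow> 'b set \<Rightarrow> ('a \<Rightarrow> 'b \<Rightarrow> real) \<Rightarrow> bool" where
  "dependent_map X Y g \<longleftrightarrow> \<not> independent_map X Y g"

end

theory Submission
  imports Defs "HOL-Real_Asymp.Real_Asymp"
begin

text \<open>
  Suppose \<open>\<Psi>\<^sub>f\<close> shatters \<open>n\<close> measures \<open>\<mu>\<close>, witnessed by measures \<open>\<nu>\<^sub>K\<close>. A union bound replaces each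
  \<open>\<nu>\<^sub>K\<close> by an average of \<open>M = O(log n)\<close> points that is accurate against the \<open>n\<close> measures \<open>\<mu>\<close> only, and
  then each \<open>\<mu>\<close> by an average of \<open>N = O(n)\<close> points that is accurate against these \<open>2 ^ n\<close> averages
  only. Now \<open>K\<close> can be read off from the traces of the \<open>M\<close> points of \<open>\<nu>\<^sub>K\<close> on the \<open>n * N\<close> points of the
  measures \<open>\<mu>\<close>, and since the formula is NIP there are only polynomially many traces (Sauer--Shelah).
  So \<open>2 ^ n\<close> is at most \<open>n ^ O(log n)\<close>, which bounds \<open>n\<close>.
\<close>

section \<open>Shattering and the Sauer-Shelah bound\<close>

definition set_shatters :: "'a set set \<Rightarrow> 'a set \<Rightarrow> bool" where
  "set_shatters F S \<longleftrightarrow> (\<forall>K\<subseteq>S. \<exists>B\<in>F. S \<inter> B = K)"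

lemma set_shattersD: "set_shatters F S \<Longrightarrow> K \<subseteq> S \<Longrightarrow> \<exists>B\<in>F. S \<inter> B = K"
  by (simp add: set_shatters_def)

text \<open>Pajor's form of the Sauer--Shelah lemma.\<close>

lemma card_le_card_shattered:
  assumes "finite P" "F \<subseteq> Pow P"
  shows "card F \<le> card {S. S \<subseteq> P \<and> set_shatters F S}"
  using assms
proof (induction P arbitrary: F rule: finite_induct)
  case empty
  show ?case
  proof (cases "F = {}")
    case False
    with empty have "F = {{}}" by auto
    moreover have "{S. S \<subseteq> {} \<and> set_shatters {{}} S} = {{}}"
      by (auto simp: set_shatters_def)
    ultimately show ?thesis
      using \<open>F = {{}}\<close> by (metis card.empty card_insert_disjoint finite.emptyI le_refl)
  qed simp
next
  case (insert p P)
  \<comment> \<open>Deleting \<open>p\<close> splits \<open>F\<close> into two families on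
    \<open>P\<close>; a set \<open>B\<close> lying in both stands for the two members
    \<open>B\<close> and \<open>insert p B\<close> of \<open>F\<close>.\<close>
  define F0 where "F0 = {B \<in> F. p \<notin> B}"
  define F1 where "F1 = {B. p \<notin> B \<and> insert p B \<in> F}"
  define sh where "sh G = {S. S \<subseteq> P \<and> set_shatters G S}" for G
  have sub: "F0 \<subseteq> Pow P" "F1 \<subseteq> Pow P"
    using insert.prems by (auto simp: F0_def F1_def)
  have fin: "finite F0" "finite F1" "finite (sh G)" for G
    using sub \<open>finite P\<close> by (auto simp: sh_def intro: finite_subset)
  have "F \<subseteq> F0 \<union> insert p ` F1"
  proof
    fix B assume "B \<in> F"
    show "B \<in> F0 \<union> insert p ` F1"
    proof (cases "p \<in> B")
      case True
      then have "insert p (B - {p}) = B" by auto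
      with \<open>B \<in> F\<close> have "B - {p} \<in> F1" by (simp add: F1_def)
      with \<open>insert p (B - {p}) = B\<close> show ?thesis by (metis UnI2 imageI)
    qed (use \<open>B \<in> F\<close> in \<open>simp add: F0_def\<close>)
  qed
  then have "card F \<le> card (F0 \<union> insert p ` F1)"
    using fin by (intro card_mono) auto
  also have "\<dots> \<le> card F0 + card F1"
    using card_Un_le[of F0 "insert p ` F1"] card_image_le[OF fin(2), of "insert p"] by linarith
  also have "\<dots> \<le> card (sh F0) + card (sh F1)"
    unfolding sh_def by (intro add_mono insert.IH sub)
  \<comment> \<open>A set shattered by both families is counted twice here. Its second count is
    charged to the set enlarged by \<open>p\<close>, which is new because subsets of
    \<open>P\<close> avoid \<open>p\<close>.\<close>
  also have "\<dots> = card (sh F0 \<union> sh F1) + card (sh F0 \<inter> sh F1)"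
    using fin by (intro card_Un_Int)
  also have "card (sh F0 \<inter> sh F1) = card (insert p ` (sh F0 \<inter> sh F1))"
  proof (rule card_image [symmetric])
    show "inj_on (insert p) (sh F0 \<inter> sh F1)"
      using insert.hyps(2) by (intro inj_onI) (auto simp: sh_def insert_ident)
  qed
  also have "card (sh F0 \<union> sh F1) + \<dots> = card ((sh F0 \<union> sh F1) \<union> insert p ` (sh F0 \<inter> sh F1))"
    using fin insert.hyps(2) by (intro card_Un_disjoint [symmetric]) (auto simp: sh_def)
  also have "\<dots> \<le> card {S. S \<subseteq> insert p P \<and> set_shatters F S}"
  proof (rule card_mono)
    show "finite {S. S \<subseteq> insert p P \<and> set_shatters F S}"
      using \<open>finite P\<close> by (auto intro: finite_subset [of _ "Pow (insert p P)"])
    have "set_shatters F S" if "S \<in> sh F0" for S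
      using that unfolding sh_def set_shatters_def F0_def by blast
    moreover have "set_shatters F S" if S: "S \<in> sh F1" for S
      unfolding set_shatters_def
    proof (intro allI impI)
      fix K assume "K \<subseteq> S"
      then obtain B where "B \<in> F1" "S \<inter> B = K"
        using S set_shattersD [of F1 S K] unfolding sh_def by blast
      moreover have "p \<notin> S" using S insert.hyps(2) by (auto simp: sh_def)
      ultimately show "\<exists>B\<in>F. S \<inter> B = K"
        by (intro bexI [of _ "insert p B"]) (auto simp: F1_def)
    qed
    \<comment> \<open>A trace containing \<open>p\<close> is cut out through \<open>F1\<close>, any
      other trace through \<open>F0\<close>; this is why both families have to shatter
      \<open>S\<close>.\<close>
    moreover have "set_shatters F (insert p S)" if S: "S \<in> sh F0" "S \<in> sh F1" for S
      unfolding set_shatters_def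
    proof (intro allI impI)
      fix K assume K: "K \<subseteq> insert p S"
      have p: "p \<notin> S" using S insert.hyps(2) by (auto simp: sh_def)
      show "\<exists>B\<in>F. insert p S \<inter> B = K"
      proof (cases "p \<in> K")
        case True
        have "K - {p} \<subseteq> S" using K by auto
        then obtain B where "B \<in> F1" "S \<inter> B = K - {p}"
          using S(2) set_shattersD [of F1 S "K - {p}"] unfolding sh_def by blast
        then show ?thesis
          using True p by (intro bexI [of _ "insert p B"]) (auto simp: F1_def)
      next
        case False
        then have "K \<subseteq> S" using K by auto
        then obtain B where "B \<in> F0" "S \<inter> B = K"
          using S(1) set_shattersD [of F0 S K] unfolding sh_def by blast
        then show ?thesis
          by (intro bexI [of _ B]) (auto simp: F0_def)
      qed
    qed
    ultimately show "(sh F0 \<union> sh F1) \<union> insert p ` (sh F0 \<inter> sh F1)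
        \<subseteq> {S. S \<subseteq> insert p P \<and> set_shatters F S}"
      by (auto simp: sh_def)
  qed
  finally show ?case .
qed

text \<open>A nonempty set of size at most \<open>d + 1\<close> arises by inserting a point of
  \<open>P\<close> into a set of size at most \<open>d\<close>, so each step in \<open>d\<close>
  costs a factor of at most \<open>1 + card P\<close>.\<close>

lemma card_subsets_card_le:
  assumes "finite P"
  shows "card {S. S \<subseteq> P \<and> card S \<le> d} \<le> (1 + card P) ^ d"
proof (induction d)
  case 0
  have "{S. S \<subseteq> P \<and> card S \<le> 0} = {{}}"
    using assms by (auto dest: finite_subset)
  then show ?case by simp
next
  case (Suc d)
  let ?G = "\<lambda>d. {S. S \<subseteq> P \<and> card S \<le> d}"
  have fin: "finite (?G d)"
    using assms by (auto intro: finite_subset [of _ "Pow P"])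
  have "?G (Suc d) \<subseteq> ?G d \<union> (\<lambda>(p, S). insert p S) ` (P \<times> ?G d)"
  proof
    fix S assume S: "S \<in> ?G (Suc d)"
    show "S \<in> ?G d \<union> (\<lambda>(p, S). insert p S) ` (P \<times> ?G d)"
    proof (cases "S = {}")
      case False
      then obtain p where p: "p \<in> S" by auto
      have "finite S" using S assms finite_subset by auto
      then have "S - {p} \<in> ?G d" using S p by auto
      moreover have "insert p (S - {p}) = S" "p \<in> P" using p S by auto
      ultimately show ?thesis by (force intro!: image_eqI [of _ _ "(p, S - {p})"])
    qed simp
  qed
  then have "card (?G (Suc d)) \<le> card (?G d \<union> (\<lambda>(p, S). insert p S) ` (P \<times> ?G d))"
    using fin assms by (intro card_mono) auto
  also have "\<dots> \<le> card (?G d) + card (P \<times> ?G d)"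
    using fin assms by (intro order_trans [OF card_Un_le] add_mono card_image_le) auto
  also have "\<dots> = (1 + card P) * card (?G d)"
    by (simp add: card_cartesian_product)
  also have "\<dots> \<le> (1 + card P) ^ Suc d"
    unfolding power_Suc by (intro mult_left_mono Suc.IH) simp
  finally show ?case .
qed

lemma card_le_vc_bound:
  assumes "finite P" "F \<subseteq> Pow P"
    and "\<And>S. S \<subseteq> P \<Longrightarrow> set_shatters F S \<Longrightarrow> card S \<le> d"
  shows "card F \<le> (1 + card P) ^ d"
proof -
  have "card F \<le> card {S. S \<subseteq> P \<and> set_shatters F S}"
    by (rule card_le_card_shattered [OF assms(1,2)])
  also have "\<dots> \<le> card {S. S \<subseteq> P \<and> card S \<le> d}"
    using assms by (intro card_mono) (auto intro: finite_subset [of _ "Pow P"])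
  also have "\<dots> \<le> (1 + card P) ^ d"
    by (rule card_subsets_card_le [OF assms(1)])
  finally show ?thesis .
qed

section \<open>Uniform approximation of averages by few sample points\<close>

lemma exists_le_weighted_sum:
  fixes w :: "'a pmf"
  assumes "finite (set_pmf w)" "(\<Sum>x\<in>set_pmf w. pmf w x * g x) \<le> (c::real)"
  shows "\<exists>x\<in>set_pmf w. g x \<le> c"
proof (rule ccontr)
  assume "\<not> ?thesis"
  then have "c < g x" if "x \<in> set_pmf w" for x using that by force
  then have "(\<Sum>x\<in>set_pmf w. pmf w x * c) < (\<Sum>x\<in>set_pmf w. pmf w x * g x)"
    using assms(1) by (intro sum_strict_mono) (auto simp: pmf_positive set_pmf_not_empty)
  with assms show False
    by (simp add: sum_pmf_eq_1 flip: sum_distrib_right)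
qed

text \<open>The moment estimate behind a Chernoff bound: average
  \<open>exp t \<le> 1 + t + t\<^sup>2\<close>, valid for t between 0 and 1, and then apply
  \<open>1 + u \<le> exp u\<close>.\<close>

lemma sum_exp_le:
  fixes w :: "'a pmf"
  assumes "finite (set_pmf w)" "\<And>x. x \<in> set_pmf w \<Longrightarrow> h x \<in> {0..1}" "0 \<le> l" "l \<le> (1::real)"
  shows "(\<Sum>x\<in>set_pmf w. pmf w x * exp (l * h x))
           \<le> exp (l * (\<Sum>x\<in>set_pmf w. pmf w x * h x) + l\<^sup>2)"
proof -
  have "(\<Sum>x\<in>set_pmf w. pmf w x * exp (l * h x))
          \<le> (\<Sum>x\<in>set_pmf w. pmf w x * (1 + l * h x + l\<^sup>2))"
  proof (intro sum_mono mult_left_mono)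
    fix x assume "x \<in> set_pmf w"
    then have h: "0 \<le> h x" "h x \<le> 1" using assms(2) by auto
    have "l * h x \<le> 1 * 1" using h assms by (intro mult_mono) auto
    then have "exp (l * h x) \<le> 1 + l * h x + (l * h x)\<^sup>2"
      using h assms by (intro exp_bound) auto
    also have "(l * h x)\<^sup>2 \<le> l\<^sup>2"
      using h assms by (intro power_mono mult_left_le) auto
    finally show "exp (l * h x) \<le> 1 + l * h x + l\<^sup>2" by simp
  qed simp
  also have "\<dots> = (\<Sum>x\<in>set_pmf w. pmf w x) * (1 + l\<^sup>2) + l * (\<Sum>x\<in>set_pmf w. pmf w x * h x)"
    unfolding sum_distrib_left sum_distrib_right sum.distrib [symmetric]
    by (simp add: algebra_simps)
  also have "\<dots> = 1 + (l * (\<Sum>x\<in>set_pmf w. pmf w x * h x) + l\<^sup>2)"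
    using assms(1) by (simp add: sum_pmf_eq_1)
  also have "\<dots> \<le> exp (l * (\<Sum>x\<in>set_pmf w. pmf w x * h x) + l\<^sup>2)"
    by (rule exp_ge_add_one_self)
  finally show ?thesis .
qed

text \<open>Points are chosen one by one so that the exponential moment never exceeds its expectation.\<close>

lemma greedy_exponential_sample:
  fixes w :: "'a pmf" and h :: "'i \<Rightarrow> 'a \<Rightarrow> real" and N :: nat and E :: "'i \<Rightarrow> real" and l :: real
  assumes "finite (set_pmf w)" "\<And>k x. k \<in> I \<Longrightarrow> x \<in> set_pmf w \<Longrightarrow> h k x \<in> {0..1}"
    and "0 \<le> l" "l \<le> 1"
  defines "E \<equiv> \<lambda>k. \<Sum>x\<in>set_pmf w. pmf w x * h k x"
  shows "\<exists>a. (\<forall>j<N. a j \<in> set_pmf w) \<and>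
           (\<Sum>k\<in>I. exp (l * ((\<Sum>j<N. h k (a j)) - N * E k))) \<le> card I * exp (N * l\<^sup>2)"
proof (induction N)
  case 0
  then show ?case by simp
next
  case (Suc N)
  then obtain a where a: "\<forall>j<N. a j \<in> set_pmf w"
    "(\<Sum>k\<in>I. exp (l * ((\<Sum>j<N. h k (a j)) - N * E k))) \<le> card I * exp (N * l\<^sup>2)" by blast
  \<comment> \<open>\<open>W k\<close> is the current weight of test \<open>k\<close>, and
    \<open>?g x\<close> is the total weight after appending \<open>x\<close>. The average of
    \<open>?g\<close> exceeds the old total by a factor of at most \<open>exp (l\<^sup>2)\<close>,
    so some \<open>x\<close> does no worse.\<close>
  define W where "W k = exp (l * ((\<Sum>j<N. h k (a j)) - N * E k))" for k
  let ?g = "\<lambda>x. \<Sum>k\<in>I. W k * exp (- l * E k) * exp (l * h k x)"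
  have "(\<Sum>x\<in>set_pmf w. pmf w x * ?g x) =
        (\<Sum>k\<in>I. W k * exp (- l * E k) * (\<Sum>x\<in>set_pmf w. pmf w x * exp (l * h k x)))"
    unfolding sum_distrib_left by (subst sum.swap) (simp add: mult_ac)
  also have "\<dots> \<le> (\<Sum>k\<in>I. W k * exp (- l * E k) * exp (l * E k + l\<^sup>2))"
    unfolding E_def using assms(1-4)
    by (intro sum_mono mult_left_mono sum_exp_le) (auto simp: W_def)
  also have "\<dots> = (\<Sum>k\<in>I. W k) * exp (l\<^sup>2)"
    by (simp add: sum_distrib_right mult.assoc flip: exp_add)
  also have "\<dots> \<le> card I * exp (N * l\<^sup>2) * exp (l\<^sup>2)"
    using a(2) by (intro mult_right_mono) (auto simp: W_def)
  also have "\<dots> = card I * exp (Suc N * l\<^sup>2)"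
    by (simp add: algebra_simps exp_add)
  finally obtain x where x: "x \<in> set_pmf w" "?g x \<le> card I * exp (Suc N * l\<^sup>2)"
    by (auto dest: exists_le_weighted_sum [OF assms(1)])
  have "(\<Sum>k\<in>I. exp (l * ((\<Sum>j<Suc N. h k ((a(N := x)) j)) - Suc N * E k))) = ?g x"
    by (intro sum.cong) (auto simp: W_def algebra_simps simp flip: exp_add)
  with x a(1) show ?case
    by (intro exI [of _ "a(N := x)"]) (auto simp: less_Suc_eq)
qed

text \<open>A union bound over an exponential moment, taken with the parameter \<open>\<delta> / 2\<close>.\<close>

lemma uniform_sample:
  fixes w :: "'a pmf" and h :: "'i \<Rightarrow> 'a \<Rightarrow> real" and N :: nat and \<delta> :: real
  assumes "finite (set_pmf w)" "finite I"
    and h: "\<And>k x. k \<in> I \<Longrightarrow> x \<in> set_pmf w \<Longrightarrow> h k x \<in> {0..1}"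
    and \<delta>: "0 < \<delta>" "\<delta> \<le> 1" and card: "2 * card I < exp (N * \<delta>\<^sup>2 / 4)"
  obtains a where "\<And>j. j < N \<Longrightarrow> a j \<in> set_pmf w"
    "\<And>k. k \<in> I \<Longrightarrow> \<bar>(\<Sum>j<N. h k (a j)) - N * (\<Sum>x\<in>set_pmf w. pmf w x * h k x)\<bar> < N * \<delta>"
proof -
  \<comment> \<open>The flag \<open>s\<close> adds the complement of each test, so that one-sided
    bounds for \<open>H\<close> become two-sided bounds for \<open>h\<close>. It also accounts for
    the factor 2 in front of \<open>card I\<close>.\<close>
  define H where "H = (\<lambda>(k, s) x. if s then h k x else 1 - h k x)"
  define J where "J = I \<times> (UNIV :: bool set)"
  define E where "E k = (\<Sum>x\<in>set_pmf w. pmf w x * h k x)" for k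
  define EH where "EH k = (\<Sum>x\<in>set_pmf w. pmf w x * H k x)" for k
  have "\<exists>a. (\<forall>j<N. a j \<in> set_pmf w) \<and>
     (\<Sum>k\<in>J. exp (\<delta> / 2 * ((\<Sum>j<N. H k (a j)) - N * EH k))) \<le> card J * exp (N * (\<delta> / 2)\<^sup>2)"
    unfolding EH_def using h \<delta> assms(1)
    by (intro greedy_exponential_sample) (auto simp: J_def H_def)
  then obtain a where a: "\<forall>j<N. a j \<in> set_pmf w"
     "(\<Sum>k\<in>J. exp (\<delta> / 2 * ((\<Sum>j<N. H k (a j)) - N * EH k))) \<le> card J * exp (N * (\<delta> / 2)\<^sup>2)"
    by blast
  have less: "(\<Sum>j<N. H k (a j)) - N * EH k < N * \<delta>" if k: "k \<in> J" for k
  proof -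
    \<comment> \<open>All terms are positive, so each one is at most the sum. With parameter
      \<open>\<delta> / 2\<close>, the count and the moment each contribute
      \<open>exp (N * \<delta>\<^sup>2 / 4)\<close>, and the product is the exponential at deviation
      \<open>N * \<delta>\<close>.\<close>
    have "exp (\<delta> / 2 * ((\<Sum>j<N. H k (a j)) - N * EH k))
            \<le> (\<Sum>k\<in>J. exp (\<delta> / 2 * ((\<Sum>j<N. H k (a j)) - N * EH k)))"
      using k assms(2) by (intro member_le_sum) (auto simp: J_def)
    also have "\<dots> \<le> card J * exp (N * (\<delta> / 2)\<^sup>2)" by (rule a)
    also have "card J = 2 * card I"
      by (simp add: J_def card_cartesian_product)
    also have "real (2 * card I) * exp (N * (\<delta> / 2)\<^sup>2) < exp (N * \<delta>\<^sup>2 / 4) * exp (N * (\<delta> / 2)\<^sup>2)"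
      using card by (intro mult_strict_right_mono) auto
    also have "\<dots> = exp (\<delta> / 2 * (N * \<delta>))"
      unfolding exp_add [symmetric] by (simp add: power2_eq_square field_simps)
    finally show ?thesis using \<delta> by simp
  qed
  have one: "EH (k, True) = E k" "EH (k, False) = 1 - E k" for k
    using sum_pmf_eq_1 [OF assms(1) order_refl]
    by (simp_all add: EH_def E_def H_def right_diff_distrib sum_subtractf)
  have "\<bar>(\<Sum>j<N. h k (a j)) - N * E k\<bar> < N * \<delta>" if "k \<in> I" for k
    using less [of "(k, True)"] less [of "(k, False)"] that one [of k]
    by (simp add: J_def H_def sum_subtractf algebra_simps)
  with a(1) that show thesis unfolding E_def by blast
qed

section \<open>Counting shattered sets of measures through sampled traces\<close>

lemma shatters_mono:
  assumes "shatters Y g r \<epsilon> A" "B \<subseteq> A"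
  shows "shatters Y g r \<epsilon> B"
  unfolding shatters_def
proof (intro allI impI)
  fix K assume "K \<subseteq> B"
  with assms(2) have "K \<subseteq> A" by simp
  with assms(1) obtain b
    where b: "b \<in> Y" "{a \<in> A. g a b \<le> r} = K" "{a \<in> A. g a b \<ge> r + \<epsilon>} = A - K"
    unfolding shatters_def by blast
  have "{a \<in> B. Q a} = {a \<in> A. Q a} \<inter> B" for Q
    using assms(2) by blast
  with b \<open>K \<subseteq> B\<close> assms(2)
  show "\<exists>b\<in>Y. {a \<in> B. g a b \<le> r} = K \<and> {a \<in> B. g a b \<ge> r + \<epsilon>} = B - K"
    by (intro bexI [of _ b]) (simp_all add: Int_absorb2, blast)
qed

text \<open>The \<open>2 ^ card A\<close> subsets inject into \<open>M\<close>-tuples of traces on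
  at most \<open>card A * N\<close> points, and the VC bound limits each entry. The conditions on
  \<open>M\<close> and \<open>N\<close> allow sampling against \<open>card A\<close> and
  \<open>2 ^ card A\<close> tests; \<open>4 * \<delta> \<le> \<epsilon>\<close> absorbs both errors
  on each side of the gap.\<close>

lemma shattered_measures_bound:
  fixes R :: "'a \<Rightarrow> 'b \<Rightarrow> bool" and M N :: nat and \<delta> :: real
  defines "f \<equiv> \<lambda>a b. of_bool (R a b) :: real"
  assumes vc: "\<And>S. finite S \<Longrightarrow> S \<subseteq> X \<Longrightarrow> (\<And>K. K \<subseteq> S \<Longrightarrow> \<exists>b\<in>Y. {a \<in> S. R a b} = K) \<Longrightarrow> card S \<le> d"
    and A: "A \<subseteq> conv_measures X" "finite A" "A \<noteq> {}"
    and sh: "shatters (conv_measures Y) (Psi f) r \<epsilon> A"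
    and \<delta>: "0 < \<delta>" "\<delta> \<le> 1" "4 * \<delta> \<le> \<epsilon>"
    and M: "2 * card A < exp (M * \<delta>\<^sup>2 / 4)" and N: "2 * 2 ^ card A < exp (N * \<delta>\<^sup>2 / 4)"
  shows "2 ^ card A \<le> (1 + card A * N) ^ (d * M)"
proof -
  have cardA: "card A \<ge> 1" using A by (simp add: Suc_leI card_gt_0_iff)
  have M0: "M > 0" using M cardA by (cases "M = 0") auto
  have N0: "N > 0"
  proof (rule ccontr)
    assume "\<not> N > 0"
    then have "2 * 2 ^ card A < (1::real)" using N by simp
    moreover have "(1::real) \<le> 2 ^ card A" by simp
    ultimately show False by linarith
  qed
  have "\<forall>K\<in>Pow A. \<exists>\<nu>. \<nu> \<in> conv_measures Y \<and>
      {\<mu> \<in> A. Psi f \<mu> \<nu> \<le> r} = K \<and> {\<mu> \<in> A. Psi f \<mu> \<nu> \<ge> r + \<epsilon>} = A - K"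
    using sh unfolding shatters_def by blast
  from bchoice [OF this]
  obtain \<nu> where \<nu>: "\<And>K. K \<subseteq> A \<Longrightarrow> \<nu> K \<in> conv_measures Y"
    "\<And>K. K \<subseteq> A \<Longrightarrow> {\<mu> \<in> A. Psi f \<mu> (\<nu> K) \<le> r} = K"
    "\<And>K. K \<subseteq> A \<Longrightarrow> {\<mu> \<in> A. Psi f \<mu> (\<nu> K) \<ge> r + \<epsilon>} = A - K"
    by (elim exE) blast
  have f01: "f a b \<in> {0..1}" for a b by (simp add: f_def)
  \<comment> \<open>\<open>q \<mu> b\<close> is the \<mu>-measure of the points related to
    \<open>b\<close>; these functions are the tests for sampling from
    \<open>\<nu> K\<close>.\<close>
  define q where "q \<mu> b = (\<Sum>x\<in>set_pmf \<mu>. pmf \<mu> x * f x b)" for \<mu> b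
  have fin\<mu>: "finite (set_pmf \<mu>)" "set_pmf \<mu> \<subseteq> X" if "\<mu> \<in> A" for \<mu>
    using that A by (auto simp: conv_measures_def)
  have fin\<nu>: "finite (set_pmf (\<nu> K))" "set_pmf (\<nu> K) \<subseteq> Y" if "K \<subseteq> A" for K
    using \<nu>(1)[OF that] by (auto simp: conv_measures_def)
  have q01: "q \<mu> b \<in> {0..1}" if "\<mu> \<in> A" for \<mu> b
  proof -
    have "q \<mu> b \<le> (\<Sum>x\<in>set_pmf \<mu>. pmf \<mu> x)"
      unfolding q_def using f01 by (intro sum_mono mult_left_le) auto
    then have "q \<mu> b \<le> 1" using sum_pmf_eq_1 [OF fin\<mu>(1)[OF that] order_refl] by simp
    moreover have "0 \<le> q \<mu> b" unfolding q_def using f01 by (intro sum_nonneg) auto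
    ultimately show ?thesis by simp
  qed
  have Psi_q: "Psi f \<mu> w = (\<Sum>b\<in>set_pmf w. pmf w b * q \<mu> b)" for \<mu> w
    unfolding Psi_def q_def sum_distrib_left by (subst sum.swap) (simp add: mult_ac)

  have "\<exists>\<beta>. (\<forall>l<M. \<beta> l \<in> set_pmf (\<nu> K)) \<and>
      (\<forall>\<mu>\<in>A. \<bar>(\<Sum>l<M. q \<mu> (\<beta> l)) - M * Psi f \<mu> (\<nu> K)\<bar> < M * \<delta>)" if "K \<subseteq> A" for K
  proof (rule uniform_sample [of "\<nu> K" A q \<delta> M])
    show "finite (set_pmf (\<nu> K))" by (rule fin\<nu>(1) [OF that])
    show "q \<mu> b \<in> {0..1}" if "\<mu> \<in> A" for \<mu> b by (rule q01 [OF that])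
    fix \<beta>
    assume "\<And>l. l < M \<Longrightarrow> \<beta> l \<in> set_pmf (\<nu> K)" "\<And>\<mu>. \<mu> \<in> A \<Longrightarrow>
      \<bar>(\<Sum>l<M. q \<mu> (\<beta> l)) - M * (\<Sum>b\<in>set_pmf (\<nu> K). pmf (\<nu> K) b * q \<mu> b)\<bar> < M * \<delta>"
    then show "\<exists>\<beta>. (\<forall>l<M. \<beta> l \<in> set_pmf (\<nu> K)) \<and>
      (\<forall>\<mu>\<in>A. \<bar>(\<Sum>l<M. q \<mu> (\<beta> l)) - M * Psi f \<mu> (\<nu> K)\<bar> < M * \<delta>)"
      unfolding Psi_q by blast
  qed (fact A(2) \<delta> M)+
  then have "\<forall>K\<in>Pow A. \<exists>\<beta>. (\<forall>l<M. \<beta> l \<in> set_pmf (\<nu> K)) \<and>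
      (\<forall>\<mu>\<in>A. \<bar>(\<Sum>l<M. q \<mu> (\<beta> l)) - M * Psi f \<mu> (\<nu> K)\<bar> < M * \<delta>)" by blast
  from bchoice [OF this]
  obtain \<beta> where \<beta>: "\<And>K l. K \<subseteq> A \<Longrightarrow> l < M \<Longrightarrow> \<beta> K l \<in> set_pmf (\<nu> K)"
    "\<And>K \<mu>. K \<subseteq> A \<Longrightarrow> \<mu> \<in> A \<Longrightarrow> \<bar>(\<Sum>l<M. q \<mu> (\<beta> K l)) - M * Psi f \<mu> (\<nu> K)\<bar> < M * \<delta>"
    by (elim exE) blast

  \<comment> \<open>The fraction of the sample \<open>\<beta> K\<close> related to \<open>x\<close>.
    The functions \<open>h K\<close>, one for each subset \<open>K\<close>, are the tests for
    sampling from \<mu>.\<close>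
  define h where "h K x = (\<Sum>l<M. f x (\<beta> K l)) / M" for K x
  have h01: "h K x \<in> {0..1}" for K x
  proof -
    have "(\<Sum>l<M. f x (\<beta> K l)) \<le> (\<Sum>l<M. 1)" using f01 by (intro sum_mono) auto
    moreover have "(\<Sum>l<M. f x (\<beta> K l)) \<ge> 0" using f01 by (intro sum_nonneg) auto
    ultimately show ?thesis using M0 by (simp add: h_def)
  qed
  have h_sum: "(\<Sum>x\<in>set_pmf \<mu>. pmf \<mu> x * h K x) = (\<Sum>l<M. q \<mu> (\<beta> K l)) / M" for \<mu> K
    unfolding h_def q_def sum_distrib_left sum_divide_distrib times_divide_eq_right
    by (rule sum.swap)
  have "\<exists>\<alpha>. (\<forall>j<N. \<alpha> j \<in> set_pmf \<mu>) \<and> (\<forall>K\<in>Pow A.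
      \<bar>(\<Sum>j<N. h K (\<alpha> j)) - N * (\<Sum>x\<in>set_pmf \<mu>. pmf \<mu> x * h K x)\<bar> < N * \<delta>)" if "\<mu> \<in> A" for \<mu>
  proof (rule uniform_sample [of \<mu> "Pow A" h \<delta> N])
    show "finite (set_pmf \<mu>)" by (rule fin\<mu>(1) [OF that])
    show "2 * card (Pow A) < exp (N * \<delta>\<^sup>2 / 4)"
      using N A by (simp add: card_Pow)
    fix \<alpha>
    assume "\<And>j. j < N \<Longrightarrow> \<alpha> j \<in> set_pmf \<mu>" "\<And>K. K \<in> Pow A \<Longrightarrow>
      \<bar>(\<Sum>j<N. h K (\<alpha> j)) - N * (\<Sum>x\<in>set_pmf \<mu>. pmf \<mu> x * h K x)\<bar> < N * \<delta>"
    then show "\<exists>\<alpha>. (\<forall>j<N. \<alpha> j \<in> set_pmf \<mu>) \<and> (\<forall>K\<in>Pow A.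
      \<bar>(\<Sum>j<N. h K (\<alpha> j)) - N * (\<Sum>x\<in>set_pmf \<mu>. pmf \<mu> x * h K x)\<bar> < N * \<delta>)" by blast
  qed (use h01 \<delta> A(2) in auto)
  then have "\<forall>\<mu>\<in>A. \<exists>\<alpha>. (\<forall>j<N. \<alpha> j \<in> set_pmf \<mu>) \<and> (\<forall>K\<in>Pow A.
      \<bar>(\<Sum>j<N. h K (\<alpha> j)) - N * ((\<Sum>l<M. q \<mu> (\<beta> K l)) / M)\<bar> < N * \<delta>)"
    unfolding h_sum by blast
  from bchoice [OF this]
  obtain \<alpha> where \<alpha>: "\<And>\<mu> j. \<mu> \<in> A \<Longrightarrow> j < N \<Longrightarrow> \<alpha> \<mu> j \<in> set_pmf \<mu>"
    "\<And>\<mu> K. \<mu> \<in> A \<Longrightarrow> K \<subseteq> A \<Longrightarrow>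
      \<bar>(\<Sum>j<N. h K (\<alpha> \<mu> j)) - N * ((\<Sum>l<M. q \<mu> (\<beta> K l)) / M)\<bar> < N * \<delta>"
    by (elim exE) blast

  define S where "S \<mu> K = (\<Sum>j<N. h K (\<alpha> \<mu> j)) / N" for \<mu> K
  have S_approx: "\<bar>S \<mu> K - Psi f \<mu> (\<nu> K)\<bar> < 2 * \<delta>" if "\<mu> \<in> A" "K \<subseteq> A" for \<mu> K
  proof -
    define Q where "Q = (\<Sum>l<M. q \<mu> (\<beta> K l)) / M"
    have avg: "\<bar>u / k - v\<bar> < \<delta>" if "\<bar>u - k * v\<bar> < k * \<delta>" "k > 0" for u v k :: real
      using that by (simp add: abs_less_iff field_simps)
    have "\<bar>S \<mu> K - Q\<bar> < \<delta>"
      unfolding S_def Q_def using \<alpha>(2) [OF that] N0 by (intro avg) auto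
    moreover have "\<bar>Q - Psi f \<mu> (\<nu> K)\<bar> < \<delta>"
      unfolding Q_def using \<beta>(2) [OF that(2,1)] M0 by (intro avg) auto
    ultimately show ?thesis by linarith
  qed
  \<comment> \<open>The threshold is the midpoint of a gap of width \<open>4 * \<delta>\<close>: for
    \<mu> outside \<open>K\<close>, \<open>S \<mu> K\<close> exceeds
    \<open>r + \<epsilon> - 2 * \<delta>\<close>, which is at least
    \<open>r + 2 * \<delta>\<close>.\<close>
  have S_iff: "\<mu> \<in> K \<longleftrightarrow> S \<mu> K < r + 2 * \<delta>" if "\<mu> \<in> A" "K \<subseteq> A" for \<mu> K
  proof (cases "\<mu> \<in> K")
    case True
    then have "Psi f \<mu> (\<nu> K) \<le> r" using \<nu>(2)[OF that(2)] by blast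
    with S_approx[OF that] True show ?thesis by (simp add: abs_less_iff)
  next
    case False
    then have "Psi f \<mu> (\<nu> K) \<ge> r + \<epsilon>" using \<nu>(3)[OF that(2)] that by blast
    with S_approx[OF that] False \<delta>(3) show ?thesis by (simp add: abs_less_iff)
  qed

  \<comment> \<open>The points \<alpha> were chosen for all \<open>K\<close> at once, so one finite
    set \<open>P\<close> serves every subset.\<close>
  define P where "P = (\<lambda>(\<mu>, j). \<alpha> \<mu> j) ` (A \<times> {..<N})"
  have P: "finite P" "P \<subseteq> X"
    using \<alpha>(1) fin\<mu> A(2) by (fastforce simp: P_def)+
  have cardP: "card P \<le> card A * N"
    unfolding P_def using A(2) by (intro order_trans [OF card_image_le]) (auto simp: card_cartesian_product)
  define F where "F = (\<lambda>b. {a \<in> P. R a b}) ` Y"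
  have F: "F \<subseteq> Pow P" "finite F"
    using P(1) by (auto simp: F_def intro: finite_subset [of _ "Pow P"])
  have "card F \<le> (1 + card P) ^ d"
  proof (rule card_le_vc_bound [OF P(1) F(1)])
    fix S assume S: "S \<subseteq> P" "set_shatters F S"
    show "card S \<le> d"
    proof (rule vc)
      show "finite S" "S \<subseteq> X" using S(1) P finite_subset by auto
      fix K assume "K \<subseteq> S"
      then obtain b where "b \<in> Y" "S \<inter> {a \<in> P. R a b} = K"
        using S(2) by (auto simp: set_shatters_def F_def)
      then show "\<exists>b\<in>Y. {a \<in> S. R a b} = K" using S(1) by blast
    qed
  qed
  also have "\<dots> \<le> (1 + card A * N) ^ d"
    using cardP by (intro power_mono) auto
  finally have cardF: "card F \<le> (1 + card A * N) ^ d" .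

  \<comment> \<open>Restricting to \<open>{..<M}\<close> makes \<open>G K\<close> extensional, hence
    an element of a function space with exactly \<open>card F ^ M\<close> members.\<close>
  define G where "G K = (\<lambda>l\<in>{..<M}. {a \<in> P. R a (\<beta> K l)})" for K
  have S_G: "S \<mu> K = S \<mu> K'" if "\<mu> \<in> A" "G K = G K'" for \<mu> K K'
  proof -
    have "R (\<alpha> \<mu> j) (\<beta> K l) \<longleftrightarrow> R (\<alpha> \<mu> j) (\<beta> K' l)" if jl: "j < N" "l < M" for j l
    proof -
      have "\<alpha> \<mu> j \<in> P" using \<open>\<mu> \<in> A\<close> jl by (auto simp: P_def)
      moreover have "G K l = G K' l" using \<open>G K = G K'\<close> by simp
      ultimately show ?thesis using jl by (auto simp: G_def)
    qed
    then show ?thesis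
      unfolding S_def h_def f_def by simp
  qed
  have "inj_on G (Pow A)"
  proof (rule inj_onI)
    fix K K' assume K: "K \<in> Pow A" "K' \<in> Pow A" "G K = G K'"
    have "\<mu> \<in> K \<longleftrightarrow> \<mu> \<in> K'" if "\<mu> \<in> A" for \<mu>
      using S_iff[OF that] S_G[OF that K(3)] K by auto
    then show "K = K'" using K by blast
  qed
  moreover have "G ` Pow A \<subseteq> {..<M} \<rightarrow>\<^sub>E F"
  proof (rule image_subsetI)
    fix K assume "K \<in> Pow A"
    then have "\<beta> K l \<in> Y" if "l < M" for l
      using \<beta>(1) [of K l] fin\<nu>(2) [of K] that by auto
    then show "G K \<in> {..<M} \<rightarrow>\<^sub>E F" by (auto simp: G_def F_def)
  qed
  ultimately have "card (Pow A) \<le> card ({..<M} \<rightarrow>\<^sub>E F)"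
    using F(2) by (intro card_inj_on_le) (auto intro: finite_PiE)
  also have "\<dots> = card F ^ M" by (simp add: card_PiE)
  also have "\<dots> \<le> ((1 + card A * N) ^ d) ^ M" by (intro power_mono cardF) auto
  finally show ?thesis using A(2) by (simp add: card_Pow power_mult)
qed

section \<open>Choice of parameters and comparison of growth\<close>

lemma two_mult_two_power_less_exp: "2 * 2 ^ m < exp (real (m + 1))"
proof -
  have "(2::real) ^ (m + 1) < exp 1 ^ (m + 1)"
    using exp_lower_Taylor_quadratic [of 1] by (intro power_strict_mono) auto
  also have "\<dots> = exp (real (m + 1))" by (simp only: exp_of_nat_mult [symmetric] mult_1_right)
  finally show ?thesis by simp
qed

text \<open>For \<open>n = 2 ^ m\<close> measures, sample sizes linear in \<open>m\<close> and in
  \<open>n\<close> suffice. The counting bound then becomes \<open>2 ^ n\<close> against a power of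
  2 whose exponent is at most quadratic in \<open>m\<close>, which fails for large
  \<open>m\<close>.\<close>

theorem finite_VC_imp_dependent_Psi:
  fixes R :: "'a \<Rightarrow> 'b \<Rightarrow> bool"
  defines "f \<equiv> \<lambda>a b. of_bool (R a b) :: real"
  assumes vc: "\<And>S. finite S \<Longrightarrow> S \<subseteq> X \<Longrightarrow> (\<And>K. K \<subseteq> S \<Longrightarrow> \<exists>b\<in>Y. {a \<in> S. R a b} = K) \<Longrightarrow> card S \<le> d"
  shows "dependent_map (conv_measures X) (conv_measures Y) (Psi f)"
  unfolding dependent_map_def
proof
  assume "independent_map (conv_measures X) (conv_measures Y) (Psi f)"
  then obtain r \<epsilon> where \<epsilon>: "\<epsilon> > 0"
    and ind: "independent_at (conv_measures X) (conv_measures Y) (Psi f) r \<epsilon>"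
    by (auto simp: independent_map_def)
  define \<delta> where "\<delta> = min 1 (\<epsilon> / 4)"
  have \<delta>: "0 < \<delta>" "\<delta> \<le> 1" "4 * \<delta> \<le> \<epsilon>" using \<epsilon> by (auto simp: \<delta>_def)
  \<comment> \<open>Sample size \<open>c * k\<close> makes the exponential in the sampling condition
    at least \<open>exp k\<close>, whatever \<delta> is.\<close>
  obtain c :: nat where c: "4 / \<delta>\<^sup>2 \<le> c" using real_arch_simple by blast
  have large: "real m \<le> real (c * m) * \<delta>\<^sup>2 / 4" for m :: nat
  proof -
    have "4 \<le> c * \<delta>\<^sup>2" using c \<delta> by (simp add: field_simps)
    then have "real m * 4 \<le> m * (real c * \<delta>\<^sup>2)" by (intro mult_left_mono) auto
    then show ?thesis by (simp add: mult_ac)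
  qed
  \<comment> \<open>The left side is the exponent of 2 reached at the end of the proof; the right
    side is \<open>n\<close>.\<close>
  have "eventually (\<lambda>m::nat. (real c + 2 * real m + 2) * d * c * (real m + 1) < 2 ^ m) at_top"
    by real_asymp
  then obtain m :: nat where "(real c + 2 * real m + 2) * d * c * (real m + 1) < 2 ^ m"
    by (meson eventually_at_top_linorder order_refl)
  then have "real ((c + 2 * m + 2) * d * c * (m + 1)) < real (2 ^ m)"
    by (simp only: of_nat_mult of_nat_add of_nat_power of_nat_numeral of_nat_1)
  then have m: "(c + 2 * m + 2) * (d * (c * (m + 1))) < 2 ^ m"
    unfolding of_nat_less_iff by (simp only: mult.assoc)
  define n :: nat where "n = 2 ^ m"
  obtain B where B: "B \<subseteq> conv_measures X" "finite B \<longrightarrow> n < card B"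
    "shatters (conv_measures Y) (Psi f) r \<epsilon> B"
    using ind unfolding independent_at_def by meson
  \<comment> \<open>Independence only supplies a set larger than \<open>n\<close>, possibly
    infinite; the parameters are tuned to exactly \<open>n\<close>.\<close>
  obtain A where A: "A \<subseteq> B" "finite A" "card A = n"
  proof (cases "finite B")
    case True
    with B(2) that show thesis by (meson less_imp_le obtain_subset_with_card_n)
  next
    case False
    with that show thesis by (meson infinite_arbitrarily_large)
  qed
  have "2 ^ card A \<le> (1 + card A * (c * (n + 1))) ^ (d * (c * (m + 1)))"
  proof (rule shattered_measures_bound [OF vc])
    show "A \<subseteq> conv_measures X" "finite A" using A B by auto
    show "A \<noteq> {}" using A by (auto simp: n_def)
    show "shatters (conv_measures Y) (Psi (\<lambda>a b. of_bool (R a b))) r \<epsilon> A"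
      using shatters_mono [OF B(3) A(1)] by (simp add: f_def)
    have "exp (real (m + 1)) \<le> exp (real (c * (m + 1)) * \<delta>\<^sup>2 / 4)"
      unfolding exp_le_cancel_iff by (rule large)
    then show "2 * card A < exp (real (c * (m + 1)) * \<delta>\<^sup>2 / 4)"
      using less_le_trans [OF two_mult_two_power_less_exp [of m]] A(3) by (simp add: n_def)
    have "exp (real (n + 1)) \<le> exp (real (c * (n + 1)) * \<delta>\<^sup>2 / 4)"
      unfolding exp_le_cancel_iff by (rule large)
    then show "2 * 2 ^ card A < exp (real (c * (n + 1)) * \<delta>\<^sup>2 / 4)"
      using less_le_trans [OF two_mult_two_power_less_exp [of n]] A(3) by simp
  qed (use \<delta> in auto)
  also have "\<dots> \<le> (2 ^ (c + 2 * m + 2)) ^ (d * (c * (m + 1)))"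
  proof (rule power_mono)
    have "n \<ge> 1" by (simp add: n_def)
    \<comment> \<open>The base is at most \<open>(c + 1) * 2 * n\<^sup>2\<close>; here
      \<open>c + 1\<close> is absorbed by \<open>2 ^ c\<close>, \<open>n\<^sup>2\<close> is
      \<open>2 ^ (2 * m)\<close>, and the remaining 2 is below 4.\<close>
    have "c + 1 \<le> 2 ^ c" using less_exp [of c] by (simp add: Suc_le_eq)
    then have "(c + 1) * (n * (n + n)) \<le> 2 ^ c * (n * (n + n))" by (intro mult_right_mono) simp_all
    moreover have "n * (c * (n + 1)) \<le> c * (n * (n + n))" 
      using \<open>n \<ge> 1\<close> by (simp add: algebra_simps)
    moreover have "1 \<le> n * (n + n)" using \<open>n \<ge> 1\<close> by simp
    ultimately have "1 + card A * (c * (n + 1)) \<le> 2 ^ c * (n * (n + n))"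
      using A by (simp only: add_mult_distrib mult_1)
    also have "\<dots> \<le> 2 ^ (c + 2 * m + 2)"
    proof -
      have "2 ^ (c + 2 * m + 2) = 2 ^ c * (n * n) * 4"
        by (simp add: n_def power_add mult_2)
      then show ?thesis by (simp add: algebra_simps)
    qed
    finally show "1 + card A * (c * (n + 1)) \<le> 2 ^ (c + 2 * m + 2)" .
  qed simp
  also have "\<dots> = 2 ^ ((c + 2 * m + 2) * (d * (c * (m + 1))))"
    by (rule power_mult [symmetric])
  also have "\<dots> < (2::nat) ^ (2 ^ m)"
    using m by (rule power_strict_increasing) simp
  finally show False by (simp only: A(3) n_def less_irrefl)
qed

theorem theorem3p12:
  fixes L :: "('f, 'r) lang"
    and T :: "('f, 'r) fm set"
    and U :: "('a, 'f, 'r) struct"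
    and \<kappa> :: "'k rel"
    and \<phi> :: "('f, 'r) fm"
    and x y :: "nat set"
  assumes "countable_lang L"
    and "is_theory L T"
    and "monster_model \<kappa> L T U"
    and "partitioned_formula L x y \<phi>"
    and "NIP U x y \<phi>"
  shows "dependent_map (conv_measures (tuples U x)) (conv_measures (tuples U y))
           (Psi (formula_fun U x \<phi>))"
proof -
  \<comment> \<open>A size \<open>d\<close> at which \<open>IP\<close> fails bounds the VC
    dimension: every finite shattered set has fewer than \<open>d\<close> elements.\<close>
  obtain d where d: "\<not> (\<exists>A\<subseteq>tuples U x. (finite A \<longrightarrow> d \<le> card A) \<and>
      (\<forall>K\<subseteq>A. \<exists>b\<in>tuples U y. {c \<in> A. holds U x \<phi> c b} = K))"
    using assms(5) unfolding NIP_def IP_def by blast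
  have "formula_fun U x \<phi> = (\<lambda>a b. of_bool (holds U x \<phi> a b))"
    by (simp add: formula_fun_def of_bool_def fun_eq_iff)
  moreover have "dependent_map (conv_measures (tuples U x)) (conv_measures (tuples U y))
      (Psi (\<lambda>a b. of_bool (holds U x \<phi> a b)))"
  proof (rule finite_VC_imp_dependent_Psi)
    fix S assume "finite S" "S \<subseteq> tuples U x"
      "\<And>K. K \<subseteq> S \<Longrightarrow> \<exists>b\<in>tuples U y. {c \<in> S. holds U x \<phi> c b} = K"
    with d have "\<not> d \<le> card S" by blast
    then show "card S \<le> d" by simp
  qed
  ultimately show ?thesis by simp
qed

end
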